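(* For all integers $N\ge r\ge0$, $$\langle W|\mathsf d^N|V^r\rangle=[y^r]\,\frac{\langle W|(\mathsf d+yA)^N|V\rangle}{\langle W|A^r|V\rangle}=\begin{bmatrix}N\\ r\end{bmatrix}_q\frac{\langle W|A^r\mathsf d^{N-r}|V\rangle}{\langle W|A^r|V\rangle}.$$
   Context: Fix generic complex parameters $a,b,c,d,q$. For integers $n\ge0$ define $\mathcal{A}_n=\frac{(1-q^{n-1}abcd)(1-q^{n+1})(1-q^nab)(1-q^nac)(1-q^nad)(1-q^nbc)(1-q^nbd)(1-q^ncd)}{(1-q^{2n-1}abcd)(1-q^{2n}abcd)^2(1-q^{2n+1}abcd)}$, $d_n^\natural=\frac{q^{n-1}}{(1-q^{2n-2}abcd)(1-q^{2n}abcd)}\big[bd(a+c)+(b+d)q-abcd(b+d)q^{n-1}-\{bd(a+c)+abcd(b+d)\}q^n-bd(a+c)q^{n+1}+ab^2cd^2(a+c)q^{2n-1}+abcd(b+d)q^{2n}\big]$, $e_n^\natural=\frac{q^{n-1}}{(1-q^{2n-2}abcd)(1-q^{2n}abcd)}\big[ac(b+d)+(a+c)q-abcd(a+c)q^{n-1}-\{ac(b+d)+abcd(a+c)\}q^n-ac(b+d)q^{n+1}+a^2bc^2d(b+d)q^{2n-1}+abcd(a+c)q^{2n}\big]$, $d_n^\sharp=1$, $d_n^\flat=-\frac{q^nbd}{(1-q^nac)(1-q^nbd)}\mathcal{A}_n$, $e_n^\sharp=-q^nac$, $e_n^\flat=\frac{\mathcal{A}_n}{(1-q^nac)(1-q^nbd)}$.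 Let $\mathsf d,\mathsf e$ be the infinite tridiagonal matrices indexed by $\{0,1,\dots\}$ with nonzero entries $\mathsf d_{n,n}=d_n^\natural$, $\mathsf d_{n,n+1}=d_n^\sharp$, $\mathsf d_{n+1,n}=d_n^\flat$, and similarly for $\mathsf e$. Put $D=\frac{1}{1-q}(I+\mathsf d)$, $E=\frac{1}{1-q}(I+\mathsf e)$, $A=DE-ED$. Let $\langle W|=(1,0,0,\dots)$, $|V\rangle=\langle W|^T$, and $|V^r\rangle$ the column vector with $1$ in position $r$ (positions indexed from $0$) and $0$ elsewhere. $[y^r]$ denotes the coefficient of $y^r$. The $q$-binomial coefficient is $\begin{bmatrix}N\\ r\end{bmatrix}_q=\frac{[N]_q!}{[r]_q![N-r]_q!}$ with $[k]_q!=\prod_{j=1}^k(1+q+\dots+q^{j-1})$. *)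

theory Defs
  imports Complex_Main "HOL-Library.Groups_Big_Fun" "HOL-Computational_Algebra.Polynomial"
begin

text \<open>
  Matrices and vectors indexed by the natural numbers.  Products use the sum of the
  finitely many nonzero terms (\<^const>\<open>Sum_any\<close>, which is \<open>0\<close> if there are infinitely many);
  for the banded matrices considered here the support is always finite.
\<close>

type_synonym 'a imat = "nat \<Rightarrow> nat \<Rightarrow> 'a"

definition imat_one :: "'a::zero_neq_one imat" where
  "imat_one i j = (if i = j then 1 else 0)"

definition imat_add :: "'a::plus imat \<Rightarrow> 'a imat \<Rightarrow> 'a imat" where
  "imat_add M N i j = M i j + N i j"

definition imat_diff :: "'a::minus imat \<Rightarrow> 'a imat \<Rightarrow> 'a imat" where
  "imat_diff M N i j = M i j - N i j"

definition imat_scale :: "'a::times \<Rightarrow> 'a imat \<Rightarrow> 'a imat" where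
  "imat_scale c M i j = c * M i j"

definition imat_mult :: "'a::semiring_0 imat \<Rightarrow> 'a imat \<Rightarrow> 'a imat" where
  "imat_mult M N i j = Sum_any (\<lambda>k. M i k * N k j)"

primrec imat_pow :: "'a::semiring_1 imat \<Rightarrow> nat \<Rightarrow> 'a imat" where
  "imat_pow M 0 = imat_one"
| "imat_pow M (Suc n) = imat_mult M (imat_pow M n)"

definition unit_vector :: "nat \<Rightarrow> nat \<Rightarrow> 'a::zero_neq_one" where
  "unit_vector r i = (if i = r then 1 else 0)"

text \<open>\<open>braket w M v\<close> is \<open>\<langle>w| M |v\<rangle>\<close>.\<close>

definition braket :: "(nat \<Rightarrow> 'a::semiring_0) \<Rightarrow> 'a imat \<Rightarrow> (nat \<Rightarrow> 'a) \<Rightarrow> 'a" where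
  "braket w M v = Sum_any (\<lambda>i. w i * Sum_any (\<lambda>j. M i j * v j))"

lemma Sum_any_single: "(\<And>i. i \<noteq> k \<Longrightarrow> f i = 0) \<Longrightarrow> Sum_any f = f k"
  by (subst Sum_any.expand_superset[of "{k}"]) auto

lemma braket_unit_vector:
  fixes M :: "'a::semiring_1 imat"
  shows "braket (unit_vector i) M (unit_vector j) = M i j"
proof -
  have "Sum_any (\<lambda>j'. M i' j' * unit_vector j j') = M i' j" for i'
    by (subst Sum_any_single[of j]) (auto simp: unit_vector_def)
  then show ?thesis
    unfolding braket_def by (subst Sum_any_single[of i]) (auto simp: unit_vector_def)
qed

definition W_vec :: "nat \<Rightarrow> 'a::zero_neq_one" where
  "W_vec = unit_vector 0"

definition V_vec :: "nat \<Rightarrow> 'a::zero_neq_one" where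
  "V_vec = unit_vector 0"

definition tridiagonal :: "(nat \<Rightarrow> 'a::zero) \<Rightarrow> (nat \<Rightarrow> 'a) \<Rightarrow> (nat \<Rightarrow> 'a) \<Rightarrow> 'a imat" where
  "tridiagonal lower diag upper i j =
     (if j = i then diag i else if j = Suc i then upper i else if i = Suc j then lower j else 0)"

text \<open>Negative powers of \<open>q\<close> occur for \<open>n = 0\<close>, hence the integer exponents.\<close>

definition AW_calA :: "complex \<Rightarrow> complex \<Rightarrow> complex \<Rightarrow> complex \<Rightarrow> complex \<Rightarrow> nat \<Rightarrow> complex" where
  "AW_calA a b c d q n =
     (1 - q powi (int n - 1) * (a*b*c*d)) * (1 - q ^ (n + 1))
       * (1 - q ^ n * (a*b)) * (1 - q ^ n * (a*c)) * (1 - q ^ n * (a*d))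
       * (1 - q ^ n * (b*c)) * (1 - q ^ n * (b*d)) * (1 - q ^ n * (c*d))
     / ((1 - q powi (2 * int n - 1) * (a*b*c*d)) * (1 - q ^ (2*n) * (a*b*c*d))\<^sup>2
        * (1 - q ^ (2*n + 1) * (a*b*c*d)))"

definition d_natural :: "complex \<Rightarrow> complex \<Rightarrow> complex \<Rightarrow> complex \<Rightarrow> complex \<Rightarrow> nat \<Rightarrow> complex" where
  "d_natural a b c d q n =
     q powi (int n - 1)
       / ((1 - q powi (2 * int n - 2) * (a*b*c*d)) * (1 - q ^ (2*n) * (a*b*c*d)))
     * (b*d*(a + c) + (b + d)*q - a*b*c*d*(b + d) * q powi (int n - 1)
        - (b*d*(a + c) + a*b*c*d*(b + d)) * q ^ n
        - b*d*(a + c) * q ^ (n + 1)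
        + a*b\<^sup>2*c*d\<^sup>2*(a + c) * q powi (2 * int n - 1)
        + a*b*c*d*(b + d) * q ^ (2*n))"

definition e_natural :: "complex \<Rightarrow> complex \<Rightarrow> complex \<Rightarrow> complex \<Rightarrow> complex \<Rightarrow> nat \<Rightarrow> complex" where
  "e_natural a b c d q n =
     q powi (int n - 1)
       / ((1 - q powi (2 * int n - 2) * (a*b*c*d)) * (1 - q ^ (2*n) * (a*b*c*d)))
     * (a*c*(b + d) + (a + c)*q - a*b*c*d*(a + c) * q powi (int n - 1)
        - (a*c*(b + d) + a*b*c*d*(a + c)) * q ^ n
        - a*c*(b + d) * q ^ (n + 1)
        + a\<^sup>2*b*c\<^sup>2*d*(b + d) * q powi (2 * int n - 1)
        + a*b*c*d*(a + c) * q ^ (2*n))"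

definition d_sharp :: "nat \<Rightarrow> complex" where
  "d_sharp n = 1"

definition d_flat :: "complex \<Rightarrow> complex \<Rightarrow> complex \<Rightarrow> complex \<Rightarrow> complex \<Rightarrow> nat \<Rightarrow> complex" where
  "d_flat a b c d q n =
     - (q ^ n * (b*d)) / ((1 - q ^ n * (a*c)) * (1 - q ^ n * (b*d))) * AW_calA a b c d q n"

definition e_sharp :: "complex \<Rightarrow> complex \<Rightarrow> complex \<Rightarrow> nat \<Rightarrow> complex" where
  "e_sharp a c q n = - (q ^ n * (a*c))"

definition e_flat :: "complex \<Rightarrow> complex \<Rightarrow> complex \<Rightarrow> complex \<Rightarrow> complex \<Rightarrow> nat \<Rightarrow> complex" where
  "e_flat a b c d q n =
     AW_calA a b c d q n / ((1 - q ^ n * (a*c)) * (1 - q ^ n * (b*d)))"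

definition small_d :: "complex \<Rightarrow> complex \<Rightarrow> complex \<Rightarrow> complex \<Rightarrow> complex \<Rightarrow> complex imat" where
  "small_d a b c d q = tridiagonal (d_flat a b c d q) (d_natural a b c d q) d_sharp"

definition small_e :: "complex \<Rightarrow> complex \<Rightarrow> complex \<Rightarrow> complex \<Rightarrow> complex \<Rightarrow> complex imat" where
  "small_e a b c d q = tridiagonal (e_flat a b c d q) (e_natural a b c d q) (e_sharp a c q)"

definition big_D :: "complex \<Rightarrow> complex \<Rightarrow> complex \<Rightarrow> complex \<Rightarrow> complex \<Rightarrow> complex imat" where
  "big_D a b c d q = imat_scale (1 / (1 - q)) (imat_add imat_one (small_d a b c d q))"

definition big_E :: "complex \<Rightarrow> complex \<Rightarrow> complex \<Rightarrow> complex \<Rightarrow> complex \<Rightarrow> complex imat" where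
  "big_E a b c d q = imat_scale (1 / (1 - q)) (imat_add imat_one (small_e a b c d q))"

definition big_A :: "complex \<Rightarrow> complex \<Rightarrow> complex \<Rightarrow> complex \<Rightarrow> complex \<Rightarrow> complex imat" where
  "big_A a b c d q =
     imat_diff (imat_mult (big_D a b c d q) (big_E a b c d q))
               (imat_mult (big_E a b c d q) (big_D a b c d q))"

text \<open>The matrix \<open>M + y N\<close> over the polynomial ring in the indeterminate \<open>y = [:0, 1:]\<close>.\<close>

definition imat_pencil :: "'a::comm_semiring_1 imat \<Rightarrow> 'a imat \<Rightarrow> 'a poly imat" where
  "imat_pencil M N =
     imat_add (\<lambda>i j. [:M i j:]) (imat_scale [:0, 1:] (\<lambda>i j. [:N i j:]))"

definition q_fact :: "'a::comm_semiring_1 \<Rightarrow> nat \<Rightarrow> 'a" where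
  "q_fact q k = (\<Prod>j=1..k. \<Sum>i<j. q ^ i)"

definition q_binomial :: "'a::field \<Rightarrow> nat \<Rightarrow> nat \<Rightarrow> 'a" where
  "q_binomial q N r = q_fact q N / (q_fact q r * q_fact q (N - r))"

end

theory Submission
  imports Defs
begin

text \<open>
  Put $t = a + c$, $v = ac$, $p = b + d$, $u = bd$ and $s = abcd$.  The matrices satisfy
  $\mathsf{d}\mathsf{e} - q\,\mathsf{e}\mathsf{d} = 1 - q$, hence $A = (1 - \mathsf{e}\mathsf{d})/(1 - q)$,
  $\mathsf{d}A = qA\mathsf{d}$ and $A\mathsf{e} = q\,\mathsf{e}A$; the second equality of the theorem is
  then the $q$-binomial theorem for the $q$-commuting pair $A$, $\mathsf{d}$.

  For the first one, $\langle W|(\mathsf{e} + v\mathsf{d}) = t\langle W|$, while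
  $(\mathsf{d} + q^r u\,\mathsf{e})|V^r\rangle$ only involves $|V^{r-1}\rangle$ and $|V^r\rangle$.
  Pushing $\mathsf{e}$ through $\mathsf{d}^N$ gives a recurrence that determines
  $\langle W|\mathsf{d}^N|V^r\rangle$ from the case $r - 1$.  In the same way the moments
  $\langle W|A^r\mathsf{d}^M|V\rangle$ satisfy a three-term recurrence in $M$, which is the one for $r = 0$
  with $a$, $c$ replaced by $q^r a$, $q^r c$.  It yields both $\langle W|A^r|V\rangle \neq 0$ and a
  contiguous relation between the normalised moments for $r - 1$ and $r$, and this relation shows that
  $q$-binomial times normalised moment obeys the same recurrence as $\langle W|\mathsf{d}^N|V^r\rangle$.
\<close>

section \<open>The ring of row-finite matrices\<close>

typedef (overloaded) ('a::zero) rf_mat = "{M :: nat \<Rightarrow> nat \<Rightarrow> 'a. \<forall>i. finite {j. M i j \<noteq> 0}}"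
  morphisms ent Rf_mat
  by (rule exI[of _ "\<lambda>_ _. 0"]) simp

setup_lifting type_definition_rf_mat

lemma finite_ent: "finite {j. ent X i j \<noteq> 0}"
  using ent[of X] by simp

lemma rf_mat_eqI: "(\<And>i j. ent X i j = ent Y i j) \<Longrightarrow> X = Y"
  by (metis ent_inject ext)

lemma imat_mult_eq_sum:
  assumes "finite K" "{k. M i k \<noteq> 0} \<subseteq> K"
  shows "imat_mult M N i j = (\<Sum>k\<in>K. M i k * N k j)"
  unfolding imat_mult_def using assms by (intro Sum_any.expand_superset) auto

lemma row_finite_imat_mult:
  assumes "\<forall>i. finite {j. M i j \<noteq> 0}" "\<forall>i. finite {j. N i j \<noteq> 0}"
  shows "\<forall>i. finite {j. imat_mult M N i j \<noteq> 0}"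
proof
  fix i
  have "{j. imat_mult M N i j \<noteq> 0} \<subseteq> (\<Union>k\<in>{k. M i k \<noteq> 0}. {j. N k j \<noteq> 0})"
  proof
    fix j assume "j \<in> {j. imat_mult M N i j \<noteq> 0}"
    hence "(\<Sum>k | M i k \<noteq> 0. M i k * N k j) \<noteq> 0"
      using assms(1) imat_mult_eq_sum[of "{k. M i k \<noteq> 0}" M i N j] by simp
    then obtain k where "M i k \<noteq> 0" "M i k * N k j \<noteq> 0"
      by (metis (mono_tags, lifting) mem_Collect_eq sum.neutral)
    thus "j \<in> (\<Union>k\<in>{k. M i k \<noteq> 0}. {j. N k j \<noteq> 0})" by auto
  qed
  thus "finite {j. imat_mult M N i j \<noteq> 0}"
    using assms by (auto intro: finite_subset)
qed

instantiation rf_mat :: (comm_ring_1) ring_1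
begin

lift_definition zero_rf_mat :: "'a rf_mat" is "\<lambda>_ _. 0" by simp

lift_definition one_rf_mat :: "'a rf_mat" is imat_one
  by (simp add: imat_one_def)

lift_definition plus_rf_mat :: "'a rf_mat \<Rightarrow> 'a rf_mat \<Rightarrow> 'a rf_mat" is imat_add
  subgoal for M N i
    by (rule finite_subset[of _ "{j. M i j \<noteq> 0} \<union> {j. N i j \<noteq> 0}"]) (auto simp: imat_add_def)
  done

lift_definition minus_rf_mat :: "'a rf_mat \<Rightarrow> 'a rf_mat \<Rightarrow> 'a rf_mat" is imat_diff
  subgoal for M N i
    by (rule finite_subset[of _ "{j. M i j \<noteq> 0} \<union> {j. N i j \<noteq> 0}"]) (auto simp: imat_diff_def)
  done

lift_definition uminus_rf_mat :: "'a rf_mat \<Rightarrow> 'a rf_mat" is "\<lambda>M i j. - M i j"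
  by simp

lift_definition times_rf_mat :: "'a rf_mat \<Rightarrow> 'a rf_mat \<Rightarrow> 'a rf_mat" is imat_mult
  using row_finite_imat_mult by blast

lemma ent_times_superset:
  assumes "finite K" "{k. ent X i k \<noteq> 0} \<subseteq> K"
  shows "ent (X * Y) i j = (\<Sum>k\<in>K. ent X i k * ent Y k j)"
  unfolding times_rf_mat.rep_eq using assms by (rule imat_mult_eq_sum)

lemma ent_times: "ent (X * Y) i j = (\<Sum>k | ent X i k \<noteq> 0. ent X i k * ent Y k j)"
  by (rule ent_times_superset) (auto simp: finite_ent)

lemma ent_simps:
  "ent 0 i j = 0" "ent 1 i j = (if i = j then 1 else 0)"
  "ent (X + Y) i j = ent X i j + ent Y i j" "ent (X - Y) i j = ent X i j - ent Y i j"
  "ent (- X) i j = - ent X i j"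
  by (simp_all add: zero_rf_mat.rep_eq one_rf_mat.rep_eq plus_rf_mat.rep_eq minus_rf_mat.rep_eq
      uminus_rf_mat.rep_eq imat_one_def imat_add_def imat_diff_def)

lemma ent_times_assoc: "ent (X * Y * Z) i j = ent (X * (Y * Z)) i j" for X Y Z :: "'a rf_mat"
proof -
  let ?K = "{k. ent X i k \<noteq> 0}"
  let ?L = "\<Union>k\<in>?K. {l. ent Y k l \<noteq> 0}"
  have fin: "finite ?K" "finite ?L" by (auto simp: finite_ent)
  have "{l. ent (X * Y) i l \<noteq> 0} \<subseteq> ?L"
  proof
    fix l assume "l \<in> {l. ent (X * Y) i l \<noteq> 0}"
    hence "(\<Sum>k\<in>?K. ent X i k * ent Y k l) \<noteq> 0" by (simp add: ent_times)
    then obtain k where "k \<in> ?K" "ent X i k * ent Y k l \<noteq> 0" by (meson sum.neutral)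
    thus "l \<in> ?L" by auto
  qed
  hence "ent (X * Y * Z) i j = (\<Sum>l\<in>?L. (\<Sum>k\<in>?K. ent X i k * ent Y k l) * ent Z l j)"
    using fin by (simp add: ent_times_superset[of ?L] ent_times[of X Y])
  also have "\<dots> = (\<Sum>k\<in>?K. \<Sum>l\<in>?L. ent X i k * (ent Y k l * ent Z l j))"
    by (subst sum.swap) (simp add: sum_distrib_right mult.assoc)
  also have "\<dots> = (\<Sum>k\<in>?K. ent X i k * ent (Y * Z) k j)"
    unfolding sum_distrib_left[symmetric]
    using fin by (intro sum.cong refl arg_cong2[of _ _ _ _ "(*)"] ent_times_superset[symmetric]) auto
  finally show ?thesis by (simp add: ent_times)
qed

instance
proof
  fix X Y Z :: "'a rf_mat"
  show "X * Y * Z = X * (Y * Z)" by (rule rf_mat_eqI) (rule ent_times_assoc)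
  show "X + Y + Z = X + (Y + Z)" "X + Y = Y + X" "0 + X = X" "- X + X = 0" "X - Y = X + - Y"
    by (auto intro!: rf_mat_eqI simp: ent_simps)
  show "(X + Y) * Z = X * Z + Y * Z"
  proof (rule rf_mat_eqI)
    fix i j
    let ?K = "{k. ent X i k \<noteq> 0} \<union> {k. ent Y i k \<noteq> 0}"
    have K: "finite ?K" "{k. ent X i k \<noteq> 0} \<subseteq> ?K" "{k. ent Y i k \<noteq> 0} \<subseteq> ?K"
      "{k. ent (X + Y) i k \<noteq> 0} \<subseteq> ?K" by (auto simp: finite_ent ent_simps)
    show "ent ((X + Y) * Z) i j = ent (X * Z + Y * Z) i j"
      using K(1) by (simp only: ent_simps ent_times_superset[OF K(1) K(2)] ent_times_superset[OF K(1) K(3)]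
         ent_times_superset[OF K(1) K(4)] sum.distrib distrib_right)
  qed
  show "X * (Y + Z) = X * Y + X * Z"
    by (rule rf_mat_eqI) (simp add: ent_times ent_simps distrib_left sum.distrib)
  show "1 * X = X"
  proof (rule rf_mat_eqI)
    fix i j
    show "ent (1 * X) i j = ent X i j"
      using ent_times_superset[of "{i}" "1 :: 'a rf_mat" i X j] by (auto simp: ent_simps)
  qed
  show "X * 1 = X"
  proof (rule rf_mat_eqI)
    fix i j
    have "ent (X * 1) i j = (\<Sum>k | ent X i k \<noteq> 0. if k = j then ent X i k else 0)"
      unfolding ent_times by (rule sum.cong) (auto simp: ent_simps)
    thus "ent (X * 1) i j = ent X i j" by (simp add: finite_ent)
  qed
  have "ent (0 :: 'a rf_mat) 0 0 \<noteq> ent 1 0 0" by (simp add: ent_simps)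
  thus "(0 :: 'a rf_mat) \<noteq> 1" by metis
qed

end

lift_definition rf_scale :: "'a::comm_ring_1 \<Rightarrow> 'a rf_mat \<Rightarrow> 'a rf_mat" (infixr "\<cdot>" 75) is imat_scale
  subgoal for c M i
    by (rule finite_subset[of _ "{j. M i j \<noteq> 0}"]) (auto simp: imat_scale_def)
  done

lemma ent_scale: "ent (c \<cdot> X) i j = c * ent X i j"
  by (simp add: rf_scale.rep_eq imat_scale_def)

interpretation rf: module rf_scale
  by unfold_locales (auto intro!: rf_mat_eqI simp: ent_simps ent_scale algebra_simps)

lemma times_scale: "X * (c \<cdot> Y) = c \<cdot> (X * Y)"
  by (rule rf_mat_eqI) (simp add: ent_scale ent_times sum_distrib_left mult.left_commute)

lemma scale_times: "(c \<cdot> X) * Y = c \<cdot> (X * Y)"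
proof (rule rf_mat_eqI)
  fix i j
  show "ent ((c \<cdot> X) * Y) i j = ent (c \<cdot> (X * Y)) i j"
    by (subst ent_times_superset[of "{k. ent X i k \<noteq> 0}"])
       (auto simp: ent_scale ent_times sum_distrib_left mult.assoc finite_ent)
qed

lemma imat_pow_ent: "imat_pow (ent X) n = ent (X ^ n)"
  by (induction n) (simp_all add: one_rf_mat.rep_eq times_rf_mat.rep_eq)

lemma ent_times_row_cong:
  assumes "\<And>k. ent X i k = ent X' i k"
  shows "ent (X * Y) i j = ent (X' * Y) i j"
  using assms by (simp add: ent_times)

lemma ent_times_column_superset:
  assumes "finite K" "{k. ent Y k j \<noteq> 0} \<subseteq> K"
  shows "ent (X * Y) i j = (\<Sum>k\<in>K. ent X i k * ent Y k j)"
  unfolding times_rf_mat.rep_eq imat_mult_def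
  using assms by (intro Sum_any.expand_superset) auto

section \<open>Scalar recurrences\<close>

lemma contiguous_moments:
  fixes H K :: "nat \<Rightarrow> 'a::field"
  assumes H0: "H 0 = 1" and K0: "K 0 = 1"
    and H: "\<And>M. (1 - q ^ M * S) * H (Suc M) = (p - u * T * q ^ M) * H M - u * (1 - q ^ M) * H (M - 1)"
    and K: "\<And>M. (1 - q ^ (M + 2) * S) * K (Suc M)
              = (p - u * T * q ^ Suc M) * K M - u * (1 - q ^ M) * K (M - 1)"
    and C: "(1 - S) * C = u * T - p * S"
    and S: "\<And>M. q ^ M * S \<noteq> 1"
  shows "(1 - q * S) * H M = (1 - q ^ Suc M * S) * K M - C * (1 - q ^ M) * K (M - 1)"
proof (induction M rule: less_induct)
  case (less M)
  show ?case
  proof (cases M)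
    case 0
    thus ?thesis by (simp add: H0 K0)
  next
    case M: (Suc N)
    define m where "m = q ^ N"
    have IH1: "(1 - q * S) * H N = (1 - q * m * S) * K N - C * (1 - m) * K (N - 1)"
      using less[of N] M by (simp add: m_def)
    have step: "u * (1 - m) * ((1 - q * S) * H (N - 1)) =
      (1 - m) * (u * (1 - m * S) * K (N - 1) - C * ((p - u * T * m) * K (N - 1) - (1 - q * m * S) * K N))"
    proof (cases N)
      case 0
      thus ?thesis by (simp add: m_def)
    next
      case (Suc L)
      define l where "l = q ^ L"
      have "(1 - q * S) * H (N - 1) = (1 - m * S) * K (N - 1) - C * (1 - l) * K (L - 1)"
        using less[of L] M Suc by (simp add: m_def l_def)
      moreover have "u * (1 - l) * K (L - 1) = (p - u * T * m) * K (N - 1) - (1 - q * m * S) * K N"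
        using K[of L] Suc by (simp add: m_def l_def algebra_simps)
      ultimately show ?thesis by algebra
    qed
    have K': "(1 - q * q * m * S) * K (Suc N) = (p - u * T * q * m) * K N - u * (1 - m) * K (N - 1)"
      using K[of N] by (simp add: m_def mult.assoc)
    have H': "(1 - m * S) * H (Suc N) = (p - u * T * m) * H N - u * (1 - m) * H (N - 1)"
      using H[of N] by (simp add: m_def)
    have "(1 - m * S) * ((1 - q * S) * H (Suc N)) =
      (p - u * T * m) * ((1 - q * S) * H N) - u * (1 - m) * ((1 - q * S) * H (N - 1))"
      using H' by algebra
    also have "\<dots> = (1 - m * S) * ((p - u * T * q * m) * K N - u * (1 - m) * K (N - 1) - C * (1 - q * m) * K N)"
      unfolding step IH1 using C by algebra
    finally have "(1 - m * S) * ((1 - q * S) * H (Suc N)) =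
      (1 - m * S) * ((1 - q * q * m * S) * K (Suc N) - C * (1 - q * m) * K N)"
      unfolding K' .
    moreover have "1 - m * S \<noteq> 0" using S[of N] by (simp add: m_def)
    ultimately have "(1 - q * S) * H (Suc N) = (1 - q * q * m * S) * K (Suc N) - C * (1 - q * m) * K N"
      using mult_left_cancel by blast
    thus ?thesis by (simp add: M m_def mult.assoc)
  qed
qed

lemma q_fact_Suc: "q_fact q (Suc k) = q_fact q k * (\<Sum>i\<le>k. q ^ i)"
  by (simp add: q_fact_def lessThan_Suc_atMost)

lemma one_minus_times_q_fact_Suc:
  fixes q :: "'a::comm_ring_1"
  shows "(1 - q) * q_fact q (Suc k) = q_fact q k * (1 - q ^ Suc k)"
  using sum_gp_basic[of q k] by (simp add: q_fact_Suc mult.left_commute)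

lemma q_fact_nonzero:
  fixes q :: "'a::field"
  assumes "\<And>k. k \<ge> 1 \<Longrightarrow> q ^ k \<noteq> 1"
  shows "q_fact q k \<noteq> 0"
proof (induction k)
  case (Suc k)
  have "(1 - q) * q_fact q (Suc k) \<noteq> 0"
    unfolding one_minus_times_q_fact_Suc using Suc assms[of "Suc k"] by simp
  thus ?case by simp
qed (simp add: q_fact_def)

lemma q_binomial_self:
  fixes q :: "'a::field"
  assumes "\<And>k. k \<ge> 1 \<Longrightarrow> q ^ k \<noteq> 1"
  shows "q_binomial q N N = 1"
  using q_fact_nonzero[OF assms] by (simp add: q_binomial_def q_fact_def)

lemma q_binomial_0:
  fixes q :: "'a::field"
  assumes "\<And>k. k \<ge> 1 \<Longrightarrow> q ^ k \<noteq> 1"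
  shows "q_binomial q N 0 = 1"
  using q_fact_nonzero[OF assms] by (simp add: q_binomial_def q_fact_def)

lemma q_binomial_Suc_upper:
  fixes q :: "'a::field"
  assumes gen: "\<And>k. k \<ge> 1 \<Longrightarrow> q ^ k \<noteq> 1"
  shows "(1 - q ^ Suc M) * q_binomial q (Suc (r + M)) r = (1 - q ^ Suc (r + M)) * q_binomial q (r + M) r"
proof -
  have nz: "q_fact q k \<noteq> 0" for k by (rule q_fact_nonzero[OF gen])
  have e: "1 - q ^ Suc k = (1 - q) * q_fact q (Suc k) / q_fact q k" for k
    using nz[of k] one_minus_times_q_fact_Suc[of q k] by (simp add: field_simps)
  have b: "q_binomial q (Suc (r + M)) r = q_fact q (Suc (r + M)) / (q_fact q r * q_fact q (Suc M))"
    "q_binomial q (r + M) r = q_fact q (r + M) / (q_fact q r * q_fact q M)"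
    by (simp_all add: q_binomial_def Suc_diff_le)
  show ?thesis unfolding e b using nz by (simp add: divide_simps)
qed

lemma q_binomial_Suc_lower:
  fixes q :: "'a::field"
  assumes gen: "\<And>k. k \<ge> 1 \<Longrightarrow> q ^ k \<noteq> 1"
  shows "(1 - q ^ Suc M) * q_binomial q (Suc (r + M)) r = (1 - q ^ Suc r) * q_binomial q (Suc (r + M)) (Suc r)"
proof -
  have nz: "q_fact q k \<noteq> 0" for k by (rule q_fact_nonzero[OF gen])
  have e: "1 - q ^ Suc k = (1 - q) * q_fact q (Suc k) / q_fact q k" for k
    using nz[of k] one_minus_times_q_fact_Suc[of q k] by (simp add: field_simps)
  have b: "q_binomial q (Suc (r + M)) r = q_fact q (Suc (r + M)) / (q_fact q r * q_fact q (Suc M))"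
    "q_binomial q (Suc (r + M)) (Suc r) = q_fact q (Suc (r + M)) / (q_fact q (Suc r) * q_fact q M)"
    by (simp_all add: q_binomial_def Suc_diff_le)
  show ?thesis unfolding e b using nz by (simp add: divide_simps)
qed

lemma q_binomial_Pascal:
  fixes q :: "'a::field"
  assumes gen: "\<And>k. k \<ge> 1 \<Longrightarrow> q ^ k \<noteq> 1" and "r < N"
  shows "q_binomial q (Suc N) (Suc r) = q ^ Suc r * q_binomial q N (Suc r) + q_binomial q N r"
proof -
  obtain M where N: "N = Suc (r + M)" using \<open>r < N\<close> less_iff_Suc_add by blast
  define B where "B = q_binomial q N (Suc r)"
  have 1: "(1 - q ^ Suc M) * q_binomial q (Suc N) (Suc r) = (1 - q ^ Suc N) * B"
    using q_binomial_Suc_upper[OF gen, of M "Suc r"] by (simp add: N B_def)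
  have 2: "(1 - q ^ Suc M) * q_binomial q N r = (1 - q ^ Suc r) * B"
    using q_binomial_Suc_lower[OF gen, of M r] by (simp add: N B_def)
  have 3: "q ^ Suc N = q ^ Suc r * q ^ Suc M" by (simp add: N power_add)
  have "(1 - q ^ Suc M) * q_binomial q (Suc N) (Suc r) = (1 - q ^ Suc M) * (q ^ Suc r * B + q_binomial q N r)"
    unfolding distrib_left 1 2 3 by (simp add: algebra_simps)
  moreover have "1 - q ^ Suc M \<noteq> 0" using gen[of "Suc M"] by simp
  ultimately show ?thesis unfolding B_def using mult_left_cancel by blast
qed

section \<open>The q-oscillator relation\<close>

lemma q_commute_power_left:
  assumes "X * Y = q \<cdot> (Y * X)"
  shows "X * Y ^ r = q ^ r \<cdot> (Y ^ r * X)"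
proof (induction r)
  case (Suc r)
  have "X * Y ^ Suc r = q \<cdot> (Y * (X * Y ^ r))"
    by (simp add: mult.assoc[symmetric] assms scale_times)
  thus ?case by (simp add: Suc times_scale mult.assoc)
qed simp

lemma q_commute_power_right:
  assumes "X * Y = q \<cdot> (Y * X)"
  shows "X ^ r * Y = q ^ r \<cdot> (Y * X ^ r)"
proof (induction r)
  case (Suc r)
  have "X ^ Suc r * Y = q ^ r \<cdot> (X * Y * X ^ r)"
    by (simp add: mult.assoc Suc times_scale)
  thus ?case by (simp add: assms scale_times mult.assoc mult.commute)
qed simp

lemma q_oscillator_power:
  assumes "d * e = q \<cdot> (e * d) + (1 - q) \<cdot> 1"
  shows "d ^ M * e = q ^ M \<cdot> (e * d ^ M) + (1 - q ^ M) \<cdot> d ^ (M - 1)"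
proof (induction M)
  case (Suc M)
  have "d ^ Suc M * e = d * (d ^ M * e)" by (simp add: mult.assoc)
  also have "\<dots> = q ^ M \<cdot> (d * e * d ^ M) + (1 - q ^ M) \<cdot> (d * d ^ (M - 1))"
    by (simp add: Suc distrib_left times_scale mult.assoc)
  also have "(1 - q ^ M) \<cdot> (d * d ^ (M - 1)) = (1 - q ^ M) \<cdot> d ^ M"
    by (cases M) simp_all
  also have "q ^ M \<cdot> (d * e * d ^ M) = q ^ Suc M \<cdot> (e * d ^ Suc M) + (q ^ M - q ^ Suc M) \<cdot> d ^ M"
    by (simp add: assms distrib_right scale_times rf.scale_right_distrib mult.assoc algebra_simps)
  also have "\<dots> + (1 - q ^ M) \<cdot> d ^ M = q ^ Suc M \<cdot> (e * d ^ Suc M) + (1 - q ^ Suc M) \<cdot> d ^ M"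
    by (simp add: add.assoc rf.scale_left_distrib[symmetric])
  finally show ?case by simp
qed simp

lemma coeff_imat_pow_pencil:
  fixes q :: "'a::field"
  assumes gen: "\<And>k. k \<ge> 1 \<Longrightarrow> q ^ k \<noteq> 1" and comm: "X * Y = q \<cdot> (Y * X)"
  shows "coeff (imat_pow (imat_pencil (ent X) (ent Y)) N i j) r =
    (if r \<le> N then q_binomial q N r * ent (Y ^ r * X ^ (N - r)) i j else 0)"
proof (induction N arbitrary: i r)
  case 0
  show ?case
    by (auto simp: imat_one_def ent_simps q_binomial_self[OF gen] gr0_conv_Suc)
next
  case (Suc N)
  let ?P = "imat_pencil (ent X) (ent Y)"
  let ?K = "{k. ent X i k \<noteq> 0} \<union> {k. ent Y i k \<noteq> 0}"
  let ?c = "\<lambda>r k. coeff (imat_pow ?P N k j) r"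
  have K: "finite ?K" "{k. ent X i k \<noteq> 0} \<subseteq> ?K" "{k. ent Y i k \<noteq> 0} \<subseteq> ?K"
      by (auto simp: finite_ent)
  have P: "?P i k = [:ent X i k, ent Y i k:]" for i k
    by (simp add: imat_pencil_def imat_add_def imat_scale_def)
  have split: "coeff (imat_pow ?P (Suc N) i j) r =
      (\<Sum>k\<in>?K. ent X i k * ?c r k) +
      (case r of 0 \<Rightarrow> 0 | Suc r' \<Rightarrow> \<Sum>k\<in>?K. ent Y i k * ?c r' k)"
  proof -
    have "imat_pow ?P (Suc N) i j = (\<Sum>k\<in>?K. ?P i k * imat_pow ?P N k j)"
      unfolding imat_pow.simps by (rule imat_mult_eq_sum[OF K(1)]) (auto simp: P)
    thus ?thesis
      by (cases r) (simp_all add: coeff_sum P sum.distrib)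
  qed
  have sX: "(\<Sum>k\<in>?K. ent X i k * (z * ent Z k j)) = z * ent (X * Z) i j" for z Z
    by (simp add: ent_times_superset[OF K(1,2)] sum_distrib_left mult.left_commute)
  have sY: "(\<Sum>k\<in>?K. ent Y i k * (z * ent Z k j)) = z * ent (Y * Z) i j" for z Z
    by (simp add: ent_times_superset[OF K(1,3)] sum_distrib_left mult.left_commute)
  have XY: "ent (X * (Y ^ r * X ^ (N - r))) i j = q ^ r * ent (Y ^ r * X ^ (Suc N - r)) i j"
    if "r \<le> N" for r
    using that by (simp add: mult.assoc[symmetric] q_commute_power_left[OF comm] scale_times ent_scale
        Suc_diff_le)
  show ?case
  proof (cases r)
    case 0
    have "coeff (imat_pow ?P (Suc N) i j) 0 = (\<Sum>k\<in>?K. ent X i k * (1 * ent (X ^ N) k j))"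
      unfolding split[unfolded 0] by (simp add: Suc q_binomial_0[OF gen])
    thus ?thesis unfolding sX by (simp add: 0 q_binomial_0[OF gen])
  next
    case r: (Suc r')
    have YY: "ent (Y * (Y ^ r' * X ^ (N - r'))) i j = ent (Y ^ r * X ^ (Suc N - r)) i j"
      by (simp add: r mult.assoc)
    consider "r' < N" | "r' = N" | "r' > N" by linarith
    thus ?thesis
    proof cases
      case 1
      thus ?thesis unfolding split
        using XY[of r] by (simp only: r Suc sX sY YY[unfolded r] q_binomial_Pascal[OF gen] nat.case
            Suc_leI less_imp_le_nat if_True Suc_le_mono) (simp add: distrib_right)
    next
      case 2
      thus ?thesis unfolding split
        using sY[of 1 "Y ^ r'"] by (simp add: r Suc q_binomial_self[OF gen])
    next
      case 3
      thus ?thesis unfolding split by (simp add: r Suc)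
    qed
  qed
qed

locale q_oscillator =
  fixes d e A :: "'a::field rf_mat" and q :: 'a
  assumes q_gen: "\<And>k. k \<ge> 1 \<Longrightarrow> q ^ k \<noteq> 1"
    and comm: "d * e = q \<cdot> (e * d) + (1 - q) \<cdot> 1"
    and A_eq: "(1 - q) \<cdot> A = 1 - e * d"
begin

lemma one_minus_q: "1 - q \<noteq> 0"
  using q_gen[of 1] by simp

lemma scale_cancel: "(1 - q) \<cdot> X = (1 - q) \<cdot> Y \<Longrightarrow> X = Y"
  by (rule rf_mat_eqI) (metis ent_scale mult_left_cancel one_minus_q)

lemma d_A: "d * A = q \<cdot> (A * d)"
proof (rule scale_cancel)
  have "(1 - q) \<cdot> (d * A) = d * (1 - e * d)" by (simp flip: A_eq add: times_scale)
  also have "\<dots> = d - (d * e) * d" by (simp add: right_diff_distrib mult.assoc)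
  also have "\<dots> = q \<cdot> ((1 - e * d) * d)"
    unfolding comm by (simp add: algebra_simps scale_times rf.scale_right_diff_distrib rf.scale_left_diff_distrib)
  also have "\<dots> = (1 - q) \<cdot> (q \<cdot> (A * d))" by (simp flip: A_eq add: scale_times mult.commute)
  finally show "(1 - q) \<cdot> (d * A) = (1 - q) \<cdot> (q \<cdot> (A * d))" .
qed

lemma A_e: "A * e = q \<cdot> (e * A)"
proof (rule scale_cancel)
  have "(1 - q) \<cdot> (A * e) = (1 - e * d) * e" by (simp flip: A_eq add: scale_times)
  also have "\<dots> = e - e * (d * e)" by (simp add: left_diff_distrib mult.assoc)
  also have "\<dots> = q \<cdot> (e * (1 - e * d))"
    unfolding comm by (simp add: algebra_simps times_scale rf.scale_right_diff_distrib rf.scale_left_diff_distrib)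
  also have "\<dots> = (1 - q) \<cdot> (q \<cdot> (e * A))" by (simp flip: A_eq add: times_scale mult.commute)
  finally show "(1 - q) \<cdot> (A * e) = (1 - q) \<cdot> (q \<cdot> (e * A))" .
qed

end

text \<open>
  \<open>norm_gen\<close> says that the factor relating $\langle W|A^{r+1}|V\rangle$ to $\langle W|A^r|V\rangle$ is nonzero.
\<close>

locale q_oscillator_boundary = q_oscillator d e A q
  for d e A :: "'a::field rf_mat" and q :: 'a +
  fixes t v p u :: 'a and C :: "nat \<Rightarrow> 'a"
  assumes row: "\<And>j. ent e 0 j = t * ent 1 0 j - v * ent d 0 j"
    and column: "\<And>i r. ent (d + (q ^ r * u) \<cdot> e) i r =
          (if i = r then C r else if Suc i = r then 1 - q ^ (2 * i + 1) * (u * v) else 0)"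
    and C_0: "C 0 = p"
    and C_Suc: "\<And>r. (1 - q ^ (2 * r) * (u * v)) * (C (Suc r) - q ^ Suc r * p)
          = (1 - q ^ Suc r) * (u * (q ^ r * t) - p * (q ^ (2 * r) * (u * v)))"
    and uv_gen: "\<And>m. q ^ m * (u * v) \<noteq> 1"
    and norm_gen: "\<And>r. (1 - q ^ (2 * r) * (u * v)) ^ 2 - q ^ r * t * p * (1 + q ^ (2 * r) * (u * v))
          + u * (q ^ r * t) ^ 2 + q ^ (2 * r) * v * p ^ 2 \<noteq> 0"
begin

lemma row_e: "ent (e * X) 0 j = t * ent X 0 j - v * ent (d * X) 0 j"
proof -
  have "ent (e * X) 0 j = ent ((t \<cdot> 1 - v \<cdot> d) * X) 0 j"
    by (rule ent_times_row_cong) (simp add: row ent_simps ent_scale)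
  thus ?thesis by (simp add: left_diff_distrib scale_times ent_simps ent_scale)
qed

lemma column_0: "u * ent (X * e) i 0 = p * ent X i 0 - ent (X * d) i 0"
proof -
  have "ent (X * (d + u \<cdot> e)) i 0 = (\<Sum>k\<in>{0}. ent X i k * ent (d + u \<cdot> e) k 0)"
    using column[of 0] by (intro ent_times_column_superset) (auto split: if_splits)
  also have "\<dots> = p * ent X i 0" using column[of 0 0] C_0 by simp
  finally show ?thesis by (simp add: distrib_left times_scale ent_simps ent_scale algebra_simps)
qed

lemma column_Suc: "ent (X * d) i (Suc r) + q ^ Suc r * u * ent (X * e) i (Suc r) =
  (1 - q ^ (2 * r + 1) * (u * v)) * ent X i r + C (Suc r) * ent X i (Suc r)"
proof -
  let ?Y = "d + (q ^ Suc r * u) \<cdot> e"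
  have "ent (X * ?Y) i (Suc r) = (\<Sum>k\<in>{r, Suc r}. ent X i k * ent ?Y k (Suc r))"
    by (intro ent_times_column_superset) (auto simp del: power_Suc simp: column split: if_splits)
  also have "\<dots> = (1 - q ^ (2 * r + 1) * (u * v)) * ent X i r + C (Suc r) * ent X i (Suc r)"
    unfolding column by simp
  finally show ?thesis by (simp add: distrib_left times_scale ent_simps ent_scale)
qed

definition moment :: "nat \<Rightarrow> nat \<Rightarrow> 'a" where
  "moment r M = ent (A ^ r * d ^ M) 0 0"

lemma row_A_power_e:
  "ent (A ^ r * (e * X)) 0 j = q ^ r * t * ent (A ^ r * X) 0 j - q ^ (2 * r) * v * ent (A ^ r * (d * X)) 0 j"
proof -
  have "ent (A ^ r * (e * X)) 0 j = q ^ r * ent (e * (A ^ r * X)) 0 j"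
    by (simp add: mult.assoc[symmetric] q_commute_power_right[OF A_e] scale_times ent_scale)
  also have "\<dots> = q ^ r * t * ent (A ^ r * X) 0 j - q ^ r * v * ent (d * (A ^ r * X)) 0 j"
    by (simp add: row_e algebra_simps)
  also have "ent (d * (A ^ r * X)) 0 j = q ^ r * ent (A ^ r * (d * X)) 0 j"
    by (simp add: mult.assoc[symmetric] q_commute_power_left[OF d_A] scale_times ent_scale)
  finally show ?thesis
    unfolding mult_2 power_add by (simp add: mult.assoc mult.left_commute)
qed

lemma moment_recurrence:
  "(1 - q ^ (M + 2 * r) * (u * v)) * moment r (Suc M) =
     (p - u * t * q ^ (M + r)) * moment r M - u * (1 - q ^ M) * moment r (M - 1)"
proof -
  have "p * moment r M - moment r (Suc M) = u * ent (A ^ r * d ^ M * e) 0 0"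
    unfolding column_0 moment_def by (simp add: mult.assoc power_Suc2 del: power_Suc)
  also have "ent (A ^ r * d ^ M * e) 0 0 =
      q ^ M * ent (A ^ r * (e * d ^ M)) 0 0 + (1 - q ^ M) * moment r (M - 1)"
    by (simp add: mult.assoc q_oscillator_power[OF comm] distrib_left times_scale ent_simps ent_scale moment_def)
  also have "ent (A ^ r * (e * d ^ M)) 0 0 = q ^ r * t * moment r M - q ^ (2 * r) * v * moment r (Suc M)"
    by (simp add: row_A_power_e moment_def)
  finally show ?thesis by (simp add: power_add algebra_simps)
qed

lemma moment_Suc_0:
  "(1 - q) * moment (Suc r) 0 = moment r 0 - q ^ r * t * moment r 1 + q ^ (2 * r) * v * moment r 2"
proof -
  have "(1 - q) * moment (Suc r) 0 = ent (A ^ r * ((1 - q) \<cdot> A)) 0 0"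
    by (simp add: moment_def times_scale ent_scale power_Suc2 del: power_Suc)
  also have "\<dots> = moment r 0 - ent (A ^ r * (e * d)) 0 0"
    unfolding A_eq by (simp add: right_diff_distrib ent_simps moment_def)
  finally show ?thesis by (simp add: row_A_power_e moment_def power2_eq_square)
qed

lemma moment_0_nonzero: "moment r 0 \<noteq> 0"
proof (induction r)
  case 0
  show ?case by (simp add: moment_def ent_simps)
next
  case (Suc r)
  define S where "S = q ^ (2 * r) * (u * v)"
  define T where "T = q ^ r * t"
  define V where "V = q ^ (2 * r) * v"
  define w where "w = moment r"
  have S: "S = u * V" by (simp add: S_def V_def)
  have w1: "(1 - S) * w 1 = (p - u * T) * w 0"
    using moment_recurrence[of 0 r] by (simp add: S_def T_def w_def mult_ac)
  have w2: "(1 - q * S) * w 2 = (p - u * T * q) * w 1 - u * (1 - q) * w 0"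
    using moment_recurrence[of 1 r] by (simp add: S_def T_def w_def mult_ac numeral_2_eq_2)
  have "(1 - S) * (1 - q * S) * ((1 - q) * moment (Suc r) 0) =
      (1 - S) * (1 - q * S) * (w 0 - T * w 1 + V * w 2)"
    unfolding moment_Suc_0 by (simp add: T_def V_def w_def)
  also have "\<dots> = ((1 - S)\<^sup>2 - T * p * (1 + S) + u * T\<^sup>2 + V * p\<^sup>2) * w 0"
    using w1 w2 S by algebra
  finally have "(1 - S) * (1 - q * S) * ((1 - q) * moment (Suc r) 0) \<noteq> 0"
    using Suc norm_gen[of r] by (simp add: S_def T_def V_def w_def)
  thus ?case by auto
qed

definition nmoment :: "nat \<Rightarrow> nat \<Rightarrow> 'a" where
  "nmoment r M = moment r M / moment r 0"

lemma nmoment_0: "nmoment r 0 = 1"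
  by (simp add: nmoment_def moment_0_nonzero)

lemma nmoment_recurrence:
  "(1 - q ^ (M + 2 * r) * (u * v)) * nmoment r (Suc M) =
     (p - u * t * q ^ (M + r)) * nmoment r M - u * (1 - q ^ M) * nmoment r (M - 1)"
  using arg_cong[OF moment_recurrence[of M r], of "\<lambda>x. x / moment r 0"]
  by (simp add: nmoment_def diff_divide_distrib)

lemma nmoment_contiguous:
  assumes "(1 - q ^ (2 * r) * (u * v)) * C' = u * (q ^ r * t) - p * (q ^ (2 * r) * (u * v))"
  shows "(1 - q ^ (2 * r + 1) * (u * v)) * nmoment r M =
    (1 - q ^ (M + 2 * r + 1) * (u * v)) * nmoment (Suc r) M - C' * (1 - q ^ M) * nmoment (Suc r) (M - 1)"
proof -
  have "(1 - q * (q ^ (2 * r) * (u * v))) * nmoment r M =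
     (1 - q ^ Suc M * (q ^ (2 * r) * (u * v))) * nmoment (Suc r) M - C' * (1 - q ^ M) * nmoment (Suc r) (M - 1)"
  proof (rule contiguous_moments[where H = "nmoment r" and K = "nmoment (Suc r)", OF nmoment_0 nmoment_0 _ _ assms])
    fix M
    show "q ^ M * (q ^ (2 * r) * (u * v)) \<noteq> 1"
      using uv_gen[of "M + 2 * r"] by (simp add: power_add mult.assoc)
    show "(1 - q ^ M * (q ^ (2 * r) * (u * v))) * nmoment r (Suc M) =
      (p - u * (q ^ r * t) * q ^ M) * nmoment r M - u * (1 - q ^ M) * nmoment r (M - 1)"
      using nmoment_recurrence[of M r] by (simp add: power_add mult_ac)
    show "(1 - q ^ (M + 2) * (q ^ (2 * r) * (u * v))) * nmoment (Suc r) (Suc M) =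
      (p - u * (q ^ r * t) * q ^ Suc M) * nmoment (Suc r) M - u * (1 - q ^ M) * nmoment (Suc r) (M - 1)"
      using nmoment_recurrence[of M "Suc r"] by (simp add: power_add mult_ac power2_eq_square)
  qed
  thus ?thesis by (simp add: power_add mult_ac)
qed

lemma row_d_power_recurrence:
  "(1 - q ^ (N + Suc r) * (u * v)) * ent (d ^ Suc N) 0 (Suc r) =
     (1 - q ^ (2 * r + 1) * (u * v)) * ent (d ^ N) 0 r
     + (C (Suc r) - q ^ (N + Suc r) * u * t) * ent (d ^ N) 0 (Suc r)
     - q ^ Suc r * u * (1 - q ^ N) * ent (d ^ (N - 1)) 0 (Suc r)"
proof -
  define n x z where "n = q ^ N" and "x = q ^ Suc r" and "z = 1 - q ^ (2 * r + 1) * (u * v)"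
  have "ent (d ^ N * e) 0 (Suc r) = n * (t * ent (d ^ N) 0 (Suc r) - v * ent (d ^ Suc N) 0 (Suc r))
     + (1 - n) * ent (d ^ (N - 1)) 0 (Suc r)"
    by (simp add: q_oscillator_power[OF comm] ent_simps ent_scale row_e n_def)
  moreover have "ent (d ^ Suc N) 0 (Suc r) + x * u * ent (d ^ N * e) 0 (Suc r) =
      z * ent (d ^ N) 0 r + C (Suc r) * ent (d ^ N) 0 (Suc r)"
    using column_Suc[of "d ^ N" 0 r] unfolding power_Suc2[of d] x_def z_def .
  ultimately have "(1 - n * x * (u * v)) * ent (d ^ Suc N) 0 (Suc r) = z * ent (d ^ N) 0 r
     + (C (Suc r) - n * x * u * t) * ent (d ^ N) 0 (Suc r)
     - x * u * (1 - n) * ent (d ^ (N - 1)) 0 (Suc r)"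
    by algebra
  thus ?thesis by (simp only: n_def x_def z_def power_add)
qed

lemma row_d_power:
  "ent (d ^ N) 0 r = (if r \<le> N then q_binomial q N r * nmoment r (N - r) else 0)"
proof (induction r arbitrary: N)
  case 0
  show ?case by (simp add: nmoment_def moment_def q_binomial_0[OF q_gen] ent_simps)
next
  case (Suc r)
  note IHr = Suc
  let ?R = "Suc r"
  show ?case
  proof (induction N rule: less_induct)
    case (less N)
    show ?case
    proof (cases N)
      case 0
      thus ?thesis by (simp add: ent_simps)
    next
      case N: (Suc L)
      have nz: "1 - q ^ (L + ?R) * (u * v) \<noteq> 0" using uv_gen[of "L + ?R"] by simp
      note rec = row_d_power_recurrence[of L r]
      have fL: "ent (d ^ L) 0 ?R = (if ?R \<le> L then q_binomial q L ?R * nmoment ?R (L - ?R) else 0)"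
        using less[of L] N by simp
      consider "L < r" | "L = r" | "L > r" by linarith
      thus ?thesis
      proof cases
        case 1
        hence "ent (d ^ (L - 1)) 0 ?R = 0" using less[of "L - 1"] N by simp
        hence "(1 - q ^ (L + ?R) * (u * v)) * ent (d ^ Suc L) 0 ?R = 0"
          using 1 IHr[of L] fL rec by simp
        thus ?thesis using nz N 1 by simp
      next
        case 2
        hence "ent (d ^ (L - 1)) 0 ?R = 0" using less[of "L - 1"] N by simp
        hence "(1 - q ^ (L + ?R) * (u * v)) * ent (d ^ Suc L) 0 ?R = 1 - q ^ (L + ?R) * (u * v)"
          using 2 IHr[of L] fL rec by (simp add: q_binomial_self[OF q_gen] nmoment_0 mult_2)
        hence "ent (d ^ Suc L) 0 ?R = 1" using nz by simp
        thus ?thesis using 2 N by (simp add: q_binomial_self[OF q_gen] nmoment_0)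
      next
        case 3
        then obtain M where L: "L = Suc (r + M)" using less_iff_Suc_add by blast
        define x m B where "x = q ^ ?R" and "m = q ^ M" and "B = q_binomial q L ?R"
        define s where "s = u * v"
        define h where "h = nmoment ?R"
        define C' where "C' = (u * (q ^ r * t) - p * (q ^ (2 * r) * (u * v))) / (1 - q ^ (2 * r) * (u * v))"
        have C'1: "(1 - q ^ (2 * r) * (u * v)) * C' = u * (q ^ r * t) - p * (q ^ (2 * r) * (u * v))"
          using uv_gen[of "2 * r"] by (simp add: C'_def)
        have C'2: "C ?R = x * p + (1 - x) * C'"
        proof -
          have "(1 - q ^ (2 * r) * (u * v)) * (C ?R - x * p) = (1 - q ^ (2 * r) * (u * v)) * ((1 - x) * C')"
            using C_Suc[of r] C'1 unfolding x_def by (metis mult.left_commute)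
          hence "C ?R - x * p = (1 - x) * C'" using uv_gen[of "2 * r"] by simp
          thus ?thesis by (simp add: algebra_simps)
        qed
        have powers: "q ^ Suc M = q * m" "q ^ L = x * m" "q ^ (L + ?R) = x\<^sup>2 * m" "q ^ Suc L = q * x * m"
          by (simp_all add: x_def m_def L power_add power2_eq_square mult_ac)
        have b1: "(1 - q * m) * q_binomial q N ?R = (1 - q * x * m) * B"
          using q_binomial_Suc_upper[OF q_gen, of M ?R] by (simp add: L N B_def x_def m_def power_add mult.assoc)
        have b2: "(1 - q * m) * q_binomial q L r = (1 - x) * B"
          using q_binomial_Suc_lower[OF q_gen, of M r] by (simp add: L B_def x_def m_def)
        have f1: "ent (d ^ L) 0 ?R = B * h M" using fL by (simp add: L B_def h_def)
        have f2: "ent (d ^ L) 0 r = q_binomial q L r * nmoment r (Suc M)"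
          using IHr[of L] by (simp add: L Suc_diff_le)
        have f3: "(1 - x * m) * ent (d ^ (L - 1)) 0 ?R = B * (1 - m) * h (M - 1)"
        proof (cases M)
          case 0
          thus ?thesis using less[of "L - 1"] N by (simp add: L m_def)
        next
          case (Suc M')
          have "(1 - q ^ L) * q_binomial q (L - 1) ?R = (1 - m) * B"
            using q_binomial_Suc_upper[OF q_gen, of M' ?R] by (simp add: L Suc B_def m_def)
          thus ?thesis using less[of "L - 1"] N by (simp add: L[symmetric] powers) (simp add: L Suc h_def mult_ac)
        qed
        have pw: "q ^ (Suc M + 2 * r + 1) = x\<^sup>2 * m" "q ^ (M + 2 * ?R) = x\<^sup>2 * m" "q ^ (M + ?R) = x * m"
          unfolding x_def m_def power2_eq_square power_add[symmetric] by (simp_all add: mult_2 add_ac)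
        have c: "(1 - q ^ (2 * r + 1) * s) * nmoment r (Suc M) = (1 - x\<^sup>2 * m * s) * h (Suc M) - C' * (1 - q * m) * h M"
          using nmoment_contiguous[OF C'1, of "Suc M"] unfolding pw powers by (simp add: h_def s_def)
        have k: "(1 - x\<^sup>2 * m * s) * h (Suc M) = (p - u * t * x * m) * h M - u * (1 - m) * h (M - 1)"
          using nmoment_recurrence[of M ?R] unfolding pw by (simp add: h_def s_def m_def mult.assoc)
        define z where "z = 1 - q ^ (2 * r + 1) * s"
        have rec': "(1 - x\<^sup>2 * m * s) * ent (d ^ N) 0 ?R = z * ent (d ^ L) 0 r
           + (x * p + (1 - x) * C' - x\<^sup>2 * m * u * t) * ent (d ^ L) 0 ?R
           - x * u * ((1 - x * m) * ent (d ^ (L - 1)) 0 ?R)"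
          using rec unfolding N powers C'2 s_def z_def x_def[symmetric] by (simp add: mult.assoc)
        have "(1 - q * m) * ((1 - x\<^sup>2 * m * s) * ent (d ^ N) 0 ?R) =
          (1 - q * m) * ((1 - x\<^sup>2 * m * s) * (q_binomial q N ?R * h (Suc M)))"
          unfolding rec' f1 f2 f3 using b1 b2 k c[folded z_def] by algebra
        moreover have "1 - q * m \<noteq> 0" "1 - x\<^sup>2 * m * s \<noteq> 0"
          using q_gen[of "Suc M"] nz powers by (auto simp: s_def)
        ultimately have "ent (d ^ N) 0 ?R = q_binomial q N ?R * h (Suc M)"
          by (metis mult_left_cancel)
        thus ?thesis by (simp add: N L h_def Suc_diff_le)
      qed
    qed
  qed
qed

theorem row_d_power_eq:
  assumes "r \<le> N"
  shows "ent (d ^ N) 0 r = coeff (imat_pow (imat_pencil (ent d) (ent A)) N 0 0) r / ent (A ^ r) 0 0"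
    and "coeff (imat_pow (imat_pencil (ent d) (ent A)) N 0 0) r = q_binomial q N r * ent (A ^ r * d ^ (N - r)) 0 0"
  using assms by (simp_all add: row_d_power coeff_imat_pow_pencil[OF q_gen d_A] nmoment_def moment_def)

end

section \<open>The Askey--Wilson tridiagonal matrices\<close>

lemma imat_mult_tridiagonal:
  "imat_mult (tridiagonal l a b) N i j =
     a i * N i j + b i * N (Suc i) j + (case i of 0 \<Rightarrow> 0 | Suc k \<Rightarrow> l k * N k j)"
proof (cases i)
  case 0
  have "imat_mult (tridiagonal l a b) N 0 j = (\<Sum>k\<in>{0, 1}. tridiagonal l a b 0 k * N k j)"
    by (rule imat_mult_eq_sum) (auto simp: tridiagonal_def split: if_splits)
  thus ?thesis by (simp add: 0 tridiagonal_def)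
next
  case (Suc k)
  have "imat_mult (tridiagonal l a b) N i j = (\<Sum>k\<in>{k, Suc k, Suc (Suc k)}. tridiagonal l a b i k * N k j)"
    by (rule imat_mult_eq_sum) (auto simp: Suc tridiagonal_def split: if_splits)
  thus ?thesis by (simp add: Suc tridiagonal_def add_ac)
qed

lemma row_finite_tridiagonal: "finite {j. tridiagonal l a b i j \<noteq> 0}"
  by (rule finite_subset[of _ "{i - 1, i, Suc i}"]) (auto simp: tridiagonal_def split: if_splits)

lemma q_commutator_tridiagonal:
  fixes q :: "'a::comm_ring_1"
  assumes "\<And>n. a n * b' n + b n * a' (Suc n) = q * (a' n * b n + b' n * a (Suc n))"
    and "\<And>n. l n * a' n + a (Suc n) * l' n = q * (l' n * a n + a' (Suc n) * l n)"
    and "\<And>n. b n * b' (Suc n) = q * (b' n * b (Suc n))"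
    and "\<And>n. l (Suc n) * l' n = q * (l' (Suc n) * l n)"
    and "a 0 * a' 0 + b 0 * l' 0 = q * (a' 0 * a 0 + b' 0 * l 0) + (1 - q)"
    and "\<And>n. l n * b' n + a (Suc n) * a' (Suc n) + b (Suc n) * l' (Suc n) =
       q * (l' n * b n + a' (Suc n) * a (Suc n) + b' (Suc n) * l (Suc n)) + (1 - q)"
  shows "imat_mult (tridiagonal l a b) (tridiagonal l' a' b') i j =
    q * imat_mult (tridiagonal l' a' b') (tridiagonal l a b) i j + (1 - q) * imat_one i j"
proof -
  consider "j = i" | "j = Suc i" | "j = Suc (Suc i)" | "i = Suc j" | "i = Suc (Suc j)"
    | "j > i + 2 \<or> i > j + 2" by linarith
  thus ?thesis
  proof cases
    case 1
    thus ?thesis using assms(5) assms(6)[of "i - 1"]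
      by (cases i) (simp_all add: imat_mult_tridiagonal tridiagonal_def imat_one_def algebra_simps)
  next
    case 2
    thus ?thesis using assms(1)[of i]
      by (cases i) (simp_all add: imat_mult_tridiagonal tridiagonal_def imat_one_def)
  next
    case 3
    thus ?thesis using assms(3)[of i]
      by (cases i) (simp_all add: imat_mult_tridiagonal tridiagonal_def imat_one_def)
  next
    case 4
    thus ?thesis using assms(2)[of j]
      by (simp add: imat_mult_tridiagonal tridiagonal_def imat_one_def add.commute)
  next
    case 5
    thus ?thesis using assms(4)[of j]
      by (simp add: imat_mult_tridiagonal tridiagonal_def imat_one_def)
  next
    case 6
    thus ?thesis
      by (cases i) (auto simp: imat_mult_tridiagonal tridiagonal_def imat_one_def)
  qed
qed

text \<open>
  With $x = q^n$ and $S = abcd/q^2$, the entry $d_n^\natural$ is \<open>natural_alpha\<close> times $bd(a+c)$ plus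
  \<open>natural_beta\<close> times $b+d$, and $e_n^\natural$ is the same with $(a,c)$ and $(b,d)$ exchanged.
\<close>

definition natural_alpha :: "complex \<Rightarrow> complex \<Rightarrow> complex \<Rightarrow> complex" where
  "natural_alpha q S x = x * (1 - x - q * x + S * q * x\<^sup>2) / (q * ((1 - S * x\<^sup>2) * (1 - S * q\<^sup>2 * x\<^sup>2)))"

definition natural_beta :: "complex \<Rightarrow> complex \<Rightarrow> complex \<Rightarrow> complex" where
  "natural_beta q S x = x * (1 - S * x - S * q * x + S * q * x\<^sup>2) / ((1 - S * x\<^sup>2) * (1 - S * q\<^sup>2 * x\<^sup>2))"

lemma d_natural_eq:
  assumes "q \<noteq> 0" and S: "a * b * c * d = S * q\<^sup>2" and x: "x = q ^ n"
  shows "d_natural a b c d q n = natural_alpha q S x * (b * d * (a + c)) + natural_beta q S x * (b + d)"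
proof -
  define u t p where "u = b * d" and "t = a + c" and "p = b + d"
  have pw: "q powi (int n - 1) = x / q" "q powi (2 * int n - 1) = x\<^sup>2 / q"
    "q powi (2 * int n - 2) = x\<^sup>2 / q\<^sup>2" "q ^ (2 * n) = x\<^sup>2" "q ^ (n + 1) = q * x" "q ^ n = x"
    using \<open>q \<noteq> 0\<close> by (simp_all add: x power_int_diff power_mult power_int_mult mult.commute[of 2] power_int_power
        power2_eq_square)
  have s2: "a * b\<^sup>2 * c * d\<^sup>2 * (a + c) = S * q\<^sup>2 * (u * t)"
    unfolding S[symmetric] by (simp add: u_def t_def power2_eq_square)
  have den: "(1 - x\<^sup>2 / q\<^sup>2 * (S * q\<^sup>2)) * (1 - x\<^sup>2 * (S * q\<^sup>2)) = (1 - S * x\<^sup>2) * (1 - S * q\<^sup>2 * x\<^sup>2)"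
    using \<open>q \<noteq> 0\<close> by (simp add: mult_ac)
  have num: "u * t + p * q - S * q\<^sup>2 * p * (x / q) - (u * t + S * q\<^sup>2 * p) * x - u * t * (q * x)
      + S * q\<^sup>2 * (u * t) * (x\<^sup>2 / q) + S * q\<^sup>2 * p * x\<^sup>2 =
      (1 - x - q * x + S * q * x\<^sup>2) * (u * t) + q * (1 - S * x - S * q * x + S * q * x\<^sup>2) * p"
    using \<open>q \<noteq> 0\<close> by (simp add: field_simps power2_eq_square)
  show ?thesis
    unfolding d_natural_def pw s2 unfolding S u_def[symmetric] t_def[symmetric] p_def[symmetric]
    unfolding den num natural_alpha_def natural_beta_def using \<open>q \<noteq> 0\<close>
    by (simp add: add_divide_distrib distrib_left mult_ac)
qed

lemma e_natural_eq:
  assumes "q \<noteq> 0" and "a * b * c * d = S * q\<^sup>2" and "x = q ^ n"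
  shows "e_natural a b c d q n = natural_alpha q S x * (a * c * (b + d)) + natural_beta q S x * (a + c)"
proof -
  have "e_natural a b c d q n = d_natural b a d c q n"
    unfolding d_natural_def e_natural_def by (simp add: mult_ac)
  thus ?thesis using d_natural_eq[of q b a d c S x n] assms by (simp add: mult_ac)
qed

lemma natural_relations:
  assumes "q \<noteq> 0" "S * x\<^sup>2 \<noteq> 1" "S * q\<^sup>2 * x\<^sup>2 \<noteq> 1"
  shows "natural_alpha q S x + x * natural_beta q S x = x * (1 - x) / (q * (1 - S * x\<^sup>2))"
    and "natural_beta q S x + x * (S * q\<^sup>2) * natural_alpha q S x = x * (1 - S * x) / (1 - S * x\<^sup>2)"
    and "q * natural_alpha q S x + x * natural_beta q S x = x * (1 - q * x) / (1 - S * q\<^sup>2 * x\<^sup>2)"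
    and "q * natural_beta q S x + x * (S * q\<^sup>2) * natural_alpha q S x = q * x * (1 - S * q * x) / (1 - S * q\<^sup>2 * x\<^sup>2)"
proof -
  define a1 a3 where "a1 = 1 - S * x\<^sup>2" and "a3 = 1 - S * q\<^sup>2 * x\<^sup>2"
  have nz: "a1 \<noteq> 0" "a3 \<noteq> 0" using assms by (auto simp: a1_def a3_def)
  note defs = natural_alpha_def natural_beta_def a1_def[symmetric] a3_def[symmetric]
  show "natural_alpha q S x + x * natural_beta q S x = x * (1 - x) / (q * (1 - S * x\<^sup>2))"
    unfolding defs using assms(1) nz by (simp add: divide_simps) (simp add: a1_def a3_def, algebra)
  show "natural_beta q S x + x * (S * q\<^sup>2) * natural_alpha q S x = x * (1 - S * x) / (1 - S * x\<^sup>2)"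
    unfolding defs using assms(1) nz by (simp add: divide_simps) (simp add: a1_def a3_def, algebra)
  show "q * natural_alpha q S x + x * natural_beta q S x = x * (1 - q * x) / (1 - S * q\<^sup>2 * x\<^sup>2)"
    unfolding defs using assms(1) nz by (simp add: divide_simps) (simp add: a1_def a3_def, algebra)
  show "q * natural_beta q S x + x * (S * q\<^sup>2) * natural_alpha q S x = q * x * (1 - S * q * x) / (1 - S * q\<^sup>2 * x\<^sup>2)"
    unfolding defs using assms(1) nz by (simp add: divide_simps) (simp add: a1_def a3_def, algebra)
qed

definition norm_poly :: "complex \<Rightarrow> complex \<Rightarrow> complex \<Rightarrow> complex \<Rightarrow> complex \<Rightarrow> complex" where
  "norm_poly t v p u x =
     (1 - x\<^sup>2 * (u * v))\<^sup>2 - x * t * p * (1 + x\<^sup>2 * (u * v)) + u * (x * t)\<^sup>2 + x\<^sup>2 * v * p\<^sup>2"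

lemma norm_poly_factor:
  "norm_poly (a + c) (a * c) (b + d) (b * d) x =
     (1 - x * (a * b)) * (1 - x * (a * d)) * (1 - x * (b * c)) * (1 - x * (c * d))"
  unfolding norm_poly_def by algebra

lemma diagonal_relation:
  assumes q: "q \<noteq> 0" and S: "S * x\<^sup>2 \<noteq> 1" "S * q * x\<^sup>2 \<noteq> 1" "S * q\<^sup>2 * x\<^sup>2 \<noteq> 1" and uv: "u * v = S * q\<^sup>2"
  shows "(1 - q) * (natural_alpha q S x * (u * t) + natural_beta q S x * p) * (natural_alpha q S x * (v * p) + natural_beta q S x * t)
    + (1 - S * q * x) * (1 - q * x) * norm_poly t v p u x / ((1 - S * q * x\<^sup>2) * (1 - S * q\<^sup>2 * x\<^sup>2)\<^sup>2)
    - q * (1 - S * x) * (1 - x) * norm_poly t v p u (x / q) / ((1 - S * x\<^sup>2)\<^sup>2 * (1 - S * q * x\<^sup>2)) = 1 - q"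
proof -
  define a1 a2 a3 where "a1 = 1 - S * x\<^sup>2" and "a2 = 1 - S * q * x\<^sup>2" and "a3 = 1 - S * q\<^sup>2 * x\<^sup>2"
  define A B where "A = 1 - x - q * x + S * q * x\<^sup>2" and "B = 1 - S * x - S * q * x + S * q * x\<^sup>2"
  define k1 k2 w where "k1 = (1 - S * q * x) * (1 - q * x)" and "k2 = (1 - S * x) * (1 - x)"
    and "w = u * t\<^sup>2 + v * p\<^sup>2"
  have nz: "a1 \<noteq> 0" "a2 \<noteq> 0" "a3 \<noteq> 0" using S by (auto simp: a1_def a2_def a3_def)
  \<comment> \<open>After clearing denominators, compare the coefficients of \<open>1\<close>, \<open>w\<close> and \<open>t * p\<close>.\<close>
  have c0: "k1 - q * k2 = (1 - q) * a2"
    unfolding k1_def k2_def a2_def by algebra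
  have c1: "(1 - q) * A * B * a2 + q * k1 * a1\<^sup>2 - k2 * a3\<^sup>2 = 0"
    unfolding k1_def k2_def a1_def a2_def a3_def A_def B_def by algebra
  have c2: "(1 - q) * x * (S * A\<^sup>2 + B\<^sup>2) * a2 - k1 * (1 + S * q\<^sup>2 * x\<^sup>2) * a1\<^sup>2 + k2 * (1 + S * x\<^sup>2) * a3\<^sup>2 = 0"
    unfolding k1_def k2_def a1_def a2_def a3_def A_def B_def by algebra
  have P1: "norm_poly t v p u x = a3\<^sup>2 - x * t * p * (1 + S * q\<^sup>2 * x\<^sup>2) + x\<^sup>2 * w"
    unfolding norm_poly_def uv a3_def w_def by algebra
  have P2: "q\<^sup>2 * norm_poly t v p u (x / q) = q\<^sup>2 * a1\<^sup>2 - q * x * t * p * (1 + S * x\<^sup>2) + x\<^sup>2 * w"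
  proof -
    define y where "y = x / q"
    have "x = q * y" using q by (simp add: y_def)
    thus ?thesis unfolding y_def[symmetric] norm_poly_def uv a1_def w_def by algebra
  qed
  let ?den = "q\<^sup>2 * a1\<^sup>2 * a2 * a3\<^sup>2"
  have al: "q * a1 * a3 * natural_alpha q S x = x * A" "a1 * a3 * natural_beta q S x = x * B"
    unfolding natural_alpha_def natural_beta_def A_def[symmetric] B_def[symmetric] a1_def[symmetric] a3_def[symmetric]
    using nz q by simp_all
  have prod: "?den * ((1 - q) * (natural_alpha q S x * (u * t) + natural_beta q S x * p) *
      (natural_alpha q S x * (v * p) + natural_beta q S x * t)) =
     a2 * (1 - q) * x\<^sup>2 * (q * A * B * w + q\<^sup>2 * (S * A\<^sup>2 + B\<^sup>2) * (t * p))"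
  proof -
    have "?den * ((1 - q) * (natural_alpha q S x * (u * t) + natural_beta q S x * p) *
      (natural_alpha q S x * (v * p) + natural_beta q S x * t)) =
      a2 * (1 - q) * (x * A * (u * t) + q * (x * B) * p) * (x * A * (v * p) + q * (x * B) * t)"
      unfolding al[symmetric] by (simp add: power2_eq_square algebra_simps)
    also have "\<dots> = a2 * (1 - q) * x\<^sup>2 * (q * A * B * w + q\<^sup>2 * (S * A\<^sup>2 + B\<^sup>2) * (t * p))"
      using uv unfolding w_def by algebra
    finally show ?thesis .
  qed
  have t1: "?den * (k1 * norm_poly t v p u x / (a2 * a3\<^sup>2)) = q\<^sup>2 * a1\<^sup>2 * k1 * norm_poly t v p u x"
    using nz by (simp add: power2_eq_square)
  have t2: "?den * (q * k2 * norm_poly t v p u (x / q) / (a1\<^sup>2 * a2)) = a3\<^sup>2 * q * k2 * (q\<^sup>2 * norm_poly t v p u (x / q))"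
    using nz by (simp add: power2_eq_square)
  define X Y Z where "X = (1 - q) * (natural_alpha q S x * (u * t) + natural_beta q S x * p) *
      (natural_alpha q S x * (v * p) + natural_beta q S x * t)"
    and "Y = k1 * norm_poly t v p u x / (a2 * a3\<^sup>2)"
    and "Z = q * k2 * norm_poly t v p u (x / q) / (a1\<^sup>2 * a2)"
  have "?den * (X + Y - Z) = ?den * X + ?den * Y - ?den * Z"
    by (simp only: distrib_left right_diff_distrib)
  also have "\<dots> = q\<^sup>2 * a1\<^sup>2 * a3\<^sup>2 * (k1 - q * k2)
     + x\<^sup>2 * w * q * ((1 - q) * A * B * a2 + q * k1 * a1\<^sup>2 - k2 * a3\<^sup>2)
     + q\<^sup>2 * x * t * p *
       ((1 - q) * x * (S * A\<^sup>2 + B\<^sup>2) * a2 - k1 * (1 + S * q\<^sup>2 * x\<^sup>2) * a1\<^sup>2 + k2 * (1 + S * x\<^sup>2) * a3\<^sup>2)"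
    unfolding prod[folded X_def] t1[folded Y_def] t2[folded Z_def] P1 P2 by algebra
  also have "\<dots> = ?den * (1 - q)" unfolding c0 c1 c2 by simp
  finally have "X + Y - Z = 1 - q" using nz q by simp
  thus ?thesis by (simp add: X_def Y_def Z_def k1_def k2_def a1_def a2_def a3_def mult.assoc)
qed

lemma e_flat_eq:
  assumes "q \<noteq> 0" and S: "a * b * c * d = S * q\<^sup>2" and x: "x = q ^ n"
    and "x * (a * c) \<noteq> 1" "x * (b * d) \<noteq> 1"
  shows "e_flat a b c d q n = (1 - S * q * x) * (1 - q * x) * norm_poly (a + c) (a * c) (b + d) (b * d) x
     / ((1 - S * q * x\<^sup>2) * (1 - S * q\<^sup>2 * x\<^sup>2)\<^sup>2 * (1 - S * q ^ 3 * x\<^sup>2))"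
proof -
  have pw: "q powi (int n - 1) = x / q" "q powi (2 * int n - 1) = x\<^sup>2 / q"
    "q ^ (2 * n) = x\<^sup>2" "q ^ (2 * n + 1) = q * x\<^sup>2" "q ^ (n + 1) = q * x" "q ^ n = x"
    using \<open>q \<noteq> 0\<close> by (simp_all add: x power_int_diff power_mult power_int_mult mult.commute[of 2] power_int_power
        power2_eq_square)
  have e: "x / q * (S * q\<^sup>2) = S * q * x" "x\<^sup>2 / q * (S * q\<^sup>2) = S * q * x\<^sup>2"
    "x\<^sup>2 * (S * q\<^sup>2) = S * q\<^sup>2 * x\<^sup>2" "q * x\<^sup>2 * (S * q\<^sup>2) = S * q ^ 3 * x\<^sup>2"
    using \<open>q \<noteq> 0\<close> by (simp_all add: power2_eq_square power3_eq_cube)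
  show ?thesis
    unfolding e_flat_def AW_calA_def pw S e norm_poly_factor using assms(4,5) by (simp add: mult.assoc)
qed


lemma aw_q_commutator:
  assumes q_nz: "q \<noteq> 0"
    and abcd_gen: "\<And>m::int. m \<ge> -2 \<Longrightarrow> q powi m * (a*b*c*d) \<noteq> 1"
    and ac_gen: "\<And>k. q ^ k * (a*c) \<noteq> 1" and bd_gen: "\<And>k. q ^ k * (b*d) \<noteq> 1"
  shows "imat_mult (small_d a b c d q) (small_e a b c d q) i j =
    q * imat_mult (small_e a b c d q) (small_d a b c d q) i j + (1 - q) * imat_one i j"
proof -
  define S where "S = a * b * c * d / q\<^sup>2"
  have S: "a * b * c * d = S * q\<^sup>2" using q_nz by (simp add: S_def)
  have gen: "S * q ^ k * (q ^ n)\<^sup>2 \<noteq> 1" for k n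
  proof -
    have "q powi (int m - 2) = q ^ m / q\<^sup>2" for m
      using q_nz by (simp add: power_int_diff)
    hence "q powi (int (k + 2 * n) - 2) = q ^ k * (q ^ n)\<^sup>2 / q\<^sup>2"
      by (simp only: power_add power_mult[symmetric] mult.commute[of n])
    thus ?thesis using abcd_gen[of "int (k + 2 * n) - 2"] by (simp add: S_def mult_ac)
  qed
  have g0: "S * (q ^ n)\<^sup>2 \<noteq> 1" and g1: "S * q * (q ^ n)\<^sup>2 \<noteq> 1" for n
    using gen[of 0 n] gen[of 1 n] by simp_all
  define t v p u where "t = a + c" and "v = a * c" and "p = b + d" and "u = b * d"
  define al be where "al n = natural_alpha q S (q ^ n)" and "be n = natural_beta q S (q ^ n)" for n
  define G where "G n = e_flat a b c d q n" for n
  have uv: "u * v = S * q\<^sup>2" using S by (simp add: u_def v_def mult_ac)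
  have dn: "d_natural a b c d q n = al n * (u * t) + be n * p" for n
    using d_natural_eq[OF q_nz S refl, of n] by (simp add: al_def be_def u_def t_def p_def)
  have en: "e_natural a b c d q n = al n * (v * p) + be n * t" for n
    using e_natural_eq[OF q_nz S refl, of n] by (simp add: al_def be_def v_def t_def p_def)
  have df: "d_flat a b c d q n = - (q ^ n * u) * G n" for n
    by (simp add: d_flat_def G_def e_flat_def u_def)
  have es: "e_sharp a c q n = - (q ^ n * v)" for n
    by (simp add: e_sharp_def v_def)
  note nr = natural_relations[OF q_nz g0 gen[of 2]]
  have r1: "al (Suc n) + q * q ^ n * be (Suc n) = q * al n + q ^ n * be n" for n
    using nr(1)[of "Suc n"] nr(3)[of n] q_nz by (simp add: al_def be_def power_mult_distrib mult_ac)
  have r2: "be (Suc n) + q * q ^ n * (S * q\<^sup>2) * al (Suc n) = q * be n + q ^ n * (S * q\<^sup>2) * al n" for n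
    using nr(2)[of "Suc n"] nr(4)[of n] q_nz by (simp add: al_def be_def power_mult_distrib mult_ac)
  define P where "P = norm_poly t v p u"
  have G: "G n = (1 - S * q * q ^ n) * (1 - q * q ^ n) * P (q ^ n)
     / ((1 - S * q * (q ^ n)\<^sup>2) * (1 - S * q\<^sup>2 * (q ^ n)\<^sup>2)\<^sup>2 * (1 - S * q ^ 3 * (q ^ n)\<^sup>2))" for n
    using e_flat_eq[OF q_nz S refl ac_gen bd_gen, of n] by (simp add: G_def P_def t_def v_def p_def u_def)
  have Gn: "(1 - S * q ^ 3 * (q ^ n)\<^sup>2) * G n =
     (1 - S * q * q ^ n) * (1 - q * q ^ n) * P (q ^ n) / ((1 - S * q * (q ^ n)\<^sup>2) * (1 - S * q\<^sup>2 * (q ^ n)\<^sup>2)\<^sup>2)" for n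
    using gen[of 3 n] unfolding G by simp
  have Gp: "(1 - S * q * (q ^ n)\<^sup>2) * G n =
     (1 - S * q ^ Suc n) * (1 - q ^ Suc n) * P (q ^ Suc n / q)
       / ((1 - S * (q ^ Suc n)\<^sup>2)\<^sup>2 * (1 - S * q * (q ^ Suc n)\<^sup>2))" for n
  proof -
    have shift: "q ^ Suc n / q = q ^ n" "S * q ^ Suc n = S * q * q ^ n" "S * (q ^ Suc n)\<^sup>2 = S * q\<^sup>2 * (q ^ n)\<^sup>2"
      "S * q * (q ^ Suc n)\<^sup>2 = S * q ^ 3 * (q ^ n)\<^sup>2"
      using q_nz by (simp_all add: power_mult_distrib power2_eq_square power3_eq_cube)
    show ?thesis unfolding shift G using g1[of n] by (simp add: mult.assoc)
  qed
  note diag = diagonal_relation[OF q_nz g0 g1 gen[of 2] uv, of _ t p, folded al_def be_def P_def]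
  show ?thesis unfolding small_d_def small_e_def
  proof (rule q_commutator_tridiagonal)
    fix n
    define x where "x = q ^ n"
    note r1 = r1[of n, folded x_def] and r2 = r2[of n, folded x_def]
    show "d_natural a b c d q n * e_sharp a c q n + d_sharp n * e_natural a b c d q (Suc n) =
        q * (e_natural a b c d q n * d_sharp n + e_sharp a c q n * d_natural a b c d q (Suc n))"
      unfolding dn en es d_sharp_def x_def[symmetric] using r1 r2 uv by algebra
    show "d_flat a b c d q n * e_natural a b c d q n + d_natural a b c d q (Suc n) * e_flat a b c d q n =
        q * (e_flat a b c d q n * d_natural a b c d q n + e_natural a b c d q (Suc n) * d_flat a b c d q n)"
      unfolding dn en df G_def[symmetric] x_def[symmetric] using r1 r2 uv by algebra
    show "d_sharp n * e_sharp a c q (Suc n) = q * (e_sharp a c q n * d_sharp (Suc n))"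
      by (simp add: d_sharp_def es)
    show "d_flat a b c d q (Suc n) * e_flat a b c d q n = q * (e_flat a b c d q (Suc n) * d_flat a b c d q n)"
      by (simp add: df flip: G_def)
    define R where "R = (1 - S * q ^ Suc n) * (1 - q ^ Suc n) * P (q ^ Suc n / q)
       / ((1 - S * (q ^ Suc n)\<^sup>2)\<^sup>2 * (1 - S * q * (q ^ Suc n)\<^sup>2))"
    define y where "y = q ^ Suc n"
    have "(1 - q) * (al (Suc n) * (u * t) + be (Suc n) * p) * (al (Suc n) * (v * p) + be (Suc n) * t)
       + (1 - S * q ^ 3 * y\<^sup>2) * G (Suc n) - q * R = 1 - q"
      unfolding y_def Gn using diag[of "Suc n"] by (simp add: R_def mult.assoc del: power_Suc)
    moreover have "(1 - S * q * x\<^sup>2) * G n = R" unfolding R_def x_def by (rule Gp)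
    moreover have "y = q * x" by (simp add: y_def x_def)
    ultimately show "d_flat a b c d q n * e_sharp a c q n + d_natural a b c d q (Suc n) * e_natural a b c d q (Suc n)
        + d_sharp (Suc n) * e_flat a b c d q (Suc n) =
       q * (e_flat a b c d q n * d_sharp n + e_natural a b c d q (Suc n) * d_natural a b c d q (Suc n)
        + e_sharp a c q (Suc n) * d_flat a b c d q (Suc n)) + (1 - q)"
      unfolding dn en df es d_sharp_def G_def[symmetric] x_def[symmetric] y_def[symmetric] using uv by algebra
  next
    have "(1 - q) * (al 0 * (u * t) + be 0 * p) * (al 0 * (v * p) + be 0 * t) + (1 - S * q ^ 3) * G 0 = 1 - q"
      using diag[of 0] Gn[of 0] by (simp add: mult.assoc)
    thus "d_natural a b c d q 0 * e_natural a b c d q 0 + d_sharp 0 * e_flat a b c d q 0 =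
       q * (e_natural a b c d q 0 * d_natural a b c d q 0 + e_sharp a c q 0 * d_flat a b c d q 0) + (1 - q)"
      unfolding dn en df es d_sharp_def G_def[symmetric] power_0 using uv by algebra
  qed
qed

lemma aw_q_oscillator_boundary:
  fixes a b c d q :: complex
  assumes q_nz: "q \<noteq> 0"
    and q_gen: "\<And>k::nat. k \<ge> 1 \<Longrightarrow> q ^ k \<noteq> 1"
    and abcd_gen: "\<And>m::int. m \<ge> -2 \<Longrightarrow> q powi m * (a*b*c*d) \<noteq> 1"
    and pair_gen: "\<And>k::nat. \<forall>p \<in> {a*b, a*c, a*d, b*c, b*d, c*d}. q ^ k * p \<noteq> 1"
    and d: "ent D = small_d a b c d q" and e: "ent E = small_e a b c d q" 
    and A: "A = ((1 / (1 - q)) \<cdot> (1 + D)) * ((1 / (1 - q)) \<cdot> (1 + E))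
             - ((1 / (1 - q)) \<cdot> (1 + E)) * ((1 / (1 - q)) \<cdot> (1 + D))"
  shows "q_oscillator_boundary D E A q (a + c) (a * c) (b + d) (b * d)
    (\<lambda>r. d_natural a b c d q r + q ^ r * (b * d) * e_natural a b c d q r)"
proof -
  have q1: "1 - q \<noteq> 0" using q_gen[of 1] by simp
  have comm: "D * E = q \<cdot> (E * D) + (1 - q) \<cdot> 1"
    using aw_q_commutator[OF q_nz abcd_gen] pair_gen
    by (intro rf_mat_eqI) (simp add: ent_simps(3) ent_scale times_rf_mat.rep_eq one_rf_mat.rep_eq d e)
  have A_eq: "(1 - q) \<cdot> A = 1 - E * D"
  proof -
    let ?z = "1 / (1 - q)"
    have "A = (?z * ?z) \<cdot> (D * E - E * D)"
      unfolding A by (simp add: scale_times times_scale algebra_simps)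
    also have "D * E - E * D = (1 - q) \<cdot> (1 - E * D)"
      unfolding comm by (simp add: algebra_simps)
    finally show ?thesis using q1 by simp
  qed
  define S where "S = a * b * c * d / q\<^sup>2"
  have S: "a * b * c * d = S * q\<^sup>2" using q_nz by (simp add: S_def)
  have pw: "q powi (int m - 2) = q ^ m / q\<^sup>2" for m
    using q_nz by (simp add: power_int_diff)
  have gen: "S * q ^ m \<noteq> 1" for m
    using abcd_gen[of "int m - 2"] by (simp add: S_def pw mult_ac)
  define t v p u where "t = a + c" and "v = a * c" and "p = b + d" and "u = b * d"
  have uv: "u * v = S * q\<^sup>2" using S by (simp add: u_def v_def mult_ac)
  define al be where "al n = natural_alpha q S (q ^ n)" and "be n = natural_beta q S (q ^ n)" for n
  have dn: "d_natural a b c d q n = al n * (u * t) + be n * p" for n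
    using d_natural_eq[OF q_nz S refl, of n] by (simp add: al_def be_def u_def t_def p_def)
  have en: "e_natural a b c d q n = al n * (v * p) + be n * t" for n
    using e_natural_eq[OF q_nz S refl, of n] by (simp add: al_def be_def v_def t_def p_def)
  have g0: "S * (q ^ n)\<^sup>2 \<noteq> 1" for n
    using gen[of "n * 2"] by (simp add: power_mult)
  have g2: "S * q\<^sup>2 * (q ^ n)\<^sup>2 \<noteq> 1" for n
    using gen[of "2 + n * 2"] by (simp only: power_add power_mult mult.assoc not_False_eq_True)
  have r1: "al n + q ^ n * be n = q ^ n * (1 - q ^ n) / (q * (1 - S * (q ^ n)\<^sup>2))"
    and r2: "be n + q ^ n * (S * q\<^sup>2) * al n = q ^ n * (1 - S * q ^ n) / (1 - S * (q ^ n)\<^sup>2)" for n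
    using natural_relations(1,2)[OF q_nz g0 g2, of n] by (simp_all add: al_def be_def)
  have z: "al 0 + be 0 = 0" "be 0 + S * q\<^sup>2 * al 0 = 1"
    using r1[of 0] r2[of 0] g0[of 0] by simp_all
  have sh: "d_sharp n = 1" "e_sharp a c q n = - (q ^ n * v)" for n
    by (simp_all add: d_sharp_def e_sharp_def v_def)
  have fl: "d_flat a b c d q n + q ^ n * u * e_flat a b c d q n = 0" for n
    by (simp add: d_flat_def e_flat_def u_def)
  show ?thesis
    unfolding t_def[symmetric] v_def[symmetric] p_def[symmetric] u_def[symmetric]
  proof (unfold_locales)
    show "D * E = q \<cdot> (E * D) + (1 - q) \<cdot> 1" by (rule comm)
    show "(1 - q) \<cdot> A = 1 - E * D" by (rule A_eq)
    show "q ^ k \<noteq> 1" if "k \<ge> 1" for k using that by (rule q_gen)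
    show "ent E 0 j = t * ent 1 0 j - v * ent D 0 j" for j
    proof -
      have "e_natural a b c d q 0 = t - v * d_natural a b c d q 0"
        unfolding dn en using z uv by algebra
      thus ?thesis by (simp add: d e small_d_def small_e_def tridiagonal_def ent_simps sh)
    qed
    show "ent (D + (q ^ r * u) \<cdot> E) i r =
        (if i = r then d_natural a b c d q r + q ^ r * u * e_natural a b c d q r
         else if Suc i = r then 1 - q ^ (2 * i + 1) * (u * v) else 0)" for i r
      using fl[of r]
      by (auto simp: d e small_d_def small_e_def tridiagonal_def ent_simps ent_scale sh mult_2 power_add)
    show "d_natural a b c d q 0 + q ^ 0 * u * e_natural a b c d q 0 = p"
      unfolding dn en power_0 using z uv by algebra
    show "(1 - q ^ (2 * r) * (u * v)) *
        (d_natural a b c d q (Suc r) + q ^ Suc r * u * e_natural a b c d q (Suc r) - q ^ Suc r * p) =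
        (1 - q ^ Suc r) * (u * (q ^ r * t) - p * (q ^ (2 * r) * (u * v)))" for r
    proof -
      define x y where "x = q ^ Suc r" and "y = q ^ r"
      have xy: "x = q * y" by (simp add: x_def y_def)
      have y2: "q ^ (2 * r) = y\<^sup>2" by (simp add: y_def mult.commute[of 2] power_mult)
      have nz: "1 - S * x\<^sup>2 \<noteq> 0" using g0[of "Suc r"] by (simp add: x_def)
      have R1: "(1 - S * x\<^sup>2) * (al (Suc r) + x * be (Suc r)) = y * (1 - x)"
        using r1[of "Suc r", folded x_def] nz q_nz by (simp add: xy)
      have R2: "(1 - S * x\<^sup>2) * (be (Suc r) + x * (S * q\<^sup>2) * al (Suc r)) = x * (1 - S * x)"
        using r2[of "Suc r", folded x_def] nz by simp
      show ?thesis unfolding dn en x_def[symmetric] y_def[symmetric] y2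
        using R1 R2 uv xy by algebra
    qed
    show "q ^ m * (u * v) \<noteq> 1" for m
      using gen[of "m + 2"] unfolding uv power_add by (simp add: mult_ac)
    show "(1 - q ^ (2 * r) * (u * v))\<^sup>2 - q ^ r * t * p * (1 + q ^ (2 * r) * (u * v))
        + u * (q ^ r * t)\<^sup>2 + q ^ (2 * r) * v * p\<^sup>2 \<noteq> 0" for r
    proof -
      have "norm_poly t v p u (q ^ r) \<noteq> 0"
        unfolding t_def v_def p_def u_def norm_poly_factor using pair_gen[of r] by auto
      thus ?thesis by (simp add: norm_poly_def mult.commute[of 2] power_mult)
    qed
  qed
qed

theorem theorem7p2:
  fixes a b c d q :: complex and N r :: nat
  assumes q_nz: "q \<noteq> 0"
    and q_gen: "\<And>k::nat. k \<ge> 1 \<Longrightarrow> q ^ k \<noteq> 1"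
    and abcd_gen: "\<And>m::int. m \<ge> -2 \<Longrightarrow> q powi m * (a*b*c*d) \<noteq> 1"
    and pair_gen: "\<And>k::nat. \<forall>p \<in> {a*b, a*c, a*d, b*c, b*d, c*d}. q ^ k * p \<noteq> 1"
    and r_le_N: "r \<le> N"
  shows
    "braket W_vec (imat_pow (small_d a b c d q) N) (unit_vector r)
       = coeff (braket W_vec
                  (imat_pow (imat_pencil (small_d a b c d q) (big_A a b c d q)) N) V_vec) r
         / braket W_vec (imat_pow (big_A a b c d q) r) V_vec
     \<and> coeff (braket W_vec
                  (imat_pow (imat_pencil (small_d a b c d q) (big_A a b c d q)) N) V_vec) r
         / braket W_vec (imat_pow (big_A a b c d q) r) V_vec
       = q_binomial q N r
         * (braket W_vec
              (imat_mult (imat_pow (big_A a b c d q) r) (imat_pow (small_d a b c d q) (N - r))) V_vec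
            / braket W_vec (imat_pow (big_A a b c d q) r) V_vec)"
proof -
  define D E where "D = Rf_mat (small_d a b c d q)" and "E = Rf_mat (small_e a b c d q)"
  have D: "ent D = small_d a b c d q" and E: "ent E = small_e a b c d q"
    unfolding D_def E_def small_d_def small_e_def
    by (simp_all add: Rf_mat_inverse row_finite_tridiagonal)
  let ?D = "(1 / (1 - q)) \<cdot> (1 + D)" and ?E = "(1 / (1 - q)) \<cdot> (1 + E)"
  define A where "A = ?D * ?E - ?E * ?D"
  have A: "ent A = big_A a b c d q"
    unfolding A_def big_A_def big_D_def big_E_def D[symmetric] E[symmetric]
      minus_rf_mat.rep_eq times_rf_mat.rep_eq rf_scale.rep_eq plus_rf_mat.rep_eq one_rf_mat.rep_eq ..
  interpret q_oscillator_boundary D E A q "a + c" "a * c" "b + d" "b * d"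
    "\<lambda>r. d_natural a b c d q r + q ^ r * (b * d) * e_natural a b c d q r"
    by (rule aw_q_oscillator_boundary[OF q_nz q_gen abcd_gen pair_gen D E A_def])
  show ?thesis
    using row_d_power_eq[OF r_le_N]
    unfolding D[symmetric] A[symmetric] W_vec_def V_vec_def braket_unit_vector imat_pow_ent
      times_rf_mat.rep_eq[symmetric]
    by simp
qed

end
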